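(* Let $L,m\geq 1$ be integers. Then $$\sum_{j_1,\ldots,j_m=-L}^{2L}\ \prod_{k=1}^{m}{2L-j_k\brack L+j_{k+1}}q^{j_k j_{k+1}+\binom{j_k+1}{2}}(-1)^{j_k}=\begin{cases}1, &\text{if } m\not\equiv 0\pmod 3,\\ 3L+1, &\text{if } m\equiv 0\pmod 3,\end{cases}$$ and $$\sum_{j_1,\ldots,j_m=-L}^{2L+1}\ \prod_{k=1}^{m}{2L-j_k+1\brack L+j_{k+1}}q^{j_k j_{k+1}+\binom{j_k}{2}}(-1)^{j_k}=\begin{cases}(-1)^{\lfloor m^2/3\rfloor}, & \text{if } m\not\equiv 0\pmod 3,\\ (-1)^{m/3}(3L+2), & \text{if } m\equiv 0\pmod 3,\end{cases}$$ where $j_{m+1}=j_1$.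
   Context: Here $q$ is an indeterminate (identities are of Laurent polynomials in $q$). The $q$-binomial coefficient is defined for integers $n,k$ by ${n\brack k}=\prod_{i=1}^{k}\frac{1-q^{n-i+1}}{1-q^i}$ if $0\leq k\leq n$, and ${n\brack k}=0$ otherwise. For any (possibly negative) integer $j$, $\binom{j}{2}=j(j-1)/2$ and $\binom{j+1}{2}=j(j+1)/2$. *)

theory Defs
  imports "HOL-Computational_Algebra.Polynomial_Factorial" "HOL-Library.FuncSet"
begin

text \<open>The indeterminate, as an element of the rational function field \<open>\<rat>(q)\<close>. This field contains
  the Laurent polynomials in \<open>q\<close>, and the quotients below can be formed in it.\<close>

definition qvar :: "rat poly fract" where
  "qvar = to_fract [:0, 1:]"

text \<open>The field element \<open>q\<close> is a parameter here; division by zero is junk unless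
  \<open>q\<close> is not a root of unity, which is the case for \<open>qvar\<close>.\<close>

definition qbinom :: "'a::field \<Rightarrow> int \<Rightarrow> int \<Rightarrow> 'a" where
  "qbinom q n k =
     (if 0 \<le> k \<and> k \<le> n
      then \<Prod>i = 1..k. (1 - q powi (n - i + 1)) / (1 - q powi i)
      else 0)"

text \<open>\<open>j (j - 1) / 2\<close> for an arbitrary, possibly negative, integer; the division is exact.\<close>

definition choose2 :: "int \<Rightarrow> int" where
  "choose2 j = j * (j - 1) div 2"

end

theory Submission
  imports Defs
begin

text \<open>Put \<open>N = 3 * L + e\<close> with \<open>e = 0\<close> in the first identity and \<open>e = 1\<close> in the second. Both left-hand
  sides are traces of \<open>A ^ m\<close> for an \<open>(N + 1) \<times> (N + 1)\<close> matrix \<open>A\<close>. At \<open>q = 1\<close> it represents, up to sign,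
  the map \<open>f x \<mapsto> (1 + x) ^ N * f (- 1 / (1 + x))\<close> on polynomials of degree at most \<open>N\<close>, and the Moebius
  transformation involved has order 3. For general \<open>q\<close>, a \<open>q\<close>-Chu-Vandermonde sum evaluates the entries of
  \<open>A ^ 2\<close> in closed form, and a second application gives that \<open>A ^ 3\<close> is \<open>(-1) ^ e\<close> times the identity. It remains to
  find the traces of \<open>A\<close> and \<open>A ^ 2\<close>. These are finite forms of Euler's pentagonal number theorem,
  which follow from a three-step recurrence in \<open>N\<close> obtained by combining the two \<open>q\<close>-Pascal rules.\<close>

section \<open>Triangular numbers and signs at arbitrary integers\<close>

lemma choose2_double: "2 * choose2 j = j * (j - 1)"
  unfolding choose2_def by simp

lemma choose2_0 [simp]: "choose2 0 = 0"
  by (simp add: choose2_def)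

lemma choose2_add: "choose2 (x + y) = choose2 x + choose2 y + x * y"
  using choose2_double[of "x + y"] choose2_double[of x] choose2_double[of y]
  by (simp add: algebra_simps)

lemma choose2_uminus: "choose2 (- x) = choose2 x + x"
  using choose2_double[of "- x"] choose2_double[of x] by (simp add: algebra_simps)

lemma choose2_diff: "choose2 (x - y) = choose2 x + choose2 y + y - x * y"
  using choose2_add[of x "- y"] by (simp add: choose2_uminus)

lemma choose2_1 [simp]: "choose2 1 = 0"
  by (simp add: choose2_def)

text \<open>\<open>choose2 (1 - e)\<close> vanishes for both values of \<open>e\<close>. This puts
  the exponents of the two identities into one form that is linear in \<open>e\<close>.\<close>

lemma choose2_diff_bit:
  assumes "e = 0 \<or> e = 1"
  shows "choose2 (i + 1 - e) = choose2 i + i * (1 - e)"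
  using assms by (auto simp: choose2_add)

definition alt_sign :: "int \<Rightarrow> 'a::field" where
  "alt_sign j = (-1) powi j"

lemma alt_sign_0 [simp]: "alt_sign 0 = 1"
  by (simp add: alt_sign_def)

lemma alt_sign_1 [simp]: "alt_sign 1 = -1"
  by (simp add: alt_sign_def)

lemma alt_sign_add: "alt_sign (x + y) = alt_sign x * alt_sign y"
  by (simp add: alt_sign_def power_int_add)

lemma alt_sign_square [simp]: "alt_sign x * alt_sign x = 1"
  by (simp add: alt_sign_def flip: power_int_mult_distrib)

lemma alt_sign_square_left [simp]: "alt_sign x * (alt_sign x * y) = y"
  by (simp flip: mult.assoc)

lemma alt_sign_uminus [simp]: "alt_sign (- x) = alt_sign x"
  using alt_sign_add[of x "- x"] alt_sign_square_left[of x "alt_sign (- x)"]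
  by (metis add.right_inverse alt_sign_0 mult.right_neutral)

lemma alt_sign_diff: "alt_sign (x - y) = alt_sign x * alt_sign y"
  using alt_sign_add[of x "- y"] by simp

lemma sum_shift_int:
  fixes f :: "int \<Rightarrow> 'a::comm_monoid_add"
  shows "(\<Sum>c=a..b. f (c - d)) = (\<Sum>c=a-d..b-d. f c)"
  by (rule sum.reindex_bij_witness[of _ "\<lambda>c. c + d" "\<lambda>c. c - d"]) auto

text \<open>Passes from a termwise Pascal rule to the sums. The shifted range starts at
  \<open>-1\<close>; the vanishing conditions cut every range down to that of the shorter
  sum.\<close>

lemma sum_minus_shift_int:
  fixes F G H :: "int \<Rightarrow> 'a::comm_ring_1"
  assumes split: "\<And>a. F a = G a - r * H (a - 1)"
    and G: "\<And>a. a < 0 \<or> a > M \<Longrightarrow> G a = 0" and H: "\<And>a. a < 0 \<or> a > K \<Longrightarrow> H a = 0"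
    and le: "M \<le> N" "K < N"
  shows "(\<Sum>a=0..N. F a) = (\<Sum>a=0..M. G a) - r * (\<Sum>a=0..K. H a)"
proof -
  have "(\<Sum>a=0..N. F a) = (\<Sum>a=0..N. G a) - r * (\<Sum>a=0..N. H (a - 1))"
    by (simp add: split sum_subtractf sum_distrib_left)
  also have "(\<Sum>a=0..N. G a) = (\<Sum>a=0..M. G a)"
    using le by (intro sum.mono_neutral_right) (auto simp: G)
  also have "(\<Sum>a=0..N. H (a - 1)) = (\<Sum>a=-1..N-1. H a)"
    by (simp add: sum_shift_int)
  also have "\<dots> = (\<Sum>a=0..K. H a)"
    using le by (intro sum.mono_neutral_right) (auto simp: H)
  finally show ?thesis .
qed

context
  fixes q :: "'a::field"
begin

text \<open>The values at \<open>t = 0\<close> are wanted; the term \<open>t * a\<close> makes the family of sums closed under both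
  \<open>q\<close>-Pascal rules.
  Up to symmetry of the \<open>q\<close>-binomial coefficient, \<open>copent 0 N\<close> is \<open>pent 0 N\<close> with \<open>q\<close> replaced by its inverse.\<close>

definition pent_term :: "int \<Rightarrow> int \<Rightarrow> int \<Rightarrow> 'a" where
  "pent_term t N a = alt_sign a * q powi (a * a + choose2 (a + 1) - N * a + t * a)
                       * qbinom q (N - a) a"

definition copent_term :: "int \<Rightarrow> int \<Rightarrow> int \<Rightarrow> 'a" where
  "copent_term t N a = alt_sign a * q powi (choose2 a + t * a) * qbinom q (N - a) (N - 2 * a)"

definition pent :: "int \<Rightarrow> int \<Rightarrow> 'a" where
  "pent t N = (\<Sum>a=0..N. pent_term t N a)"

definition copent :: "int \<Rightarrow> int \<Rightarrow> 'a" where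
  "copent t N = (\<Sum>a=0..N. copent_term t N a)"

text \<open>One factor of the product, with \<open>i\<close> for \<open>j_k\<close> and
  \<open>j\<close> for \<open>j_(k+1)\<close>, read as a matrix entry; \<open>e\<close> selects the
  identity.\<close>

definition cyc :: "int \<Rightarrow> int \<Rightarrow> int \<Rightarrow> int \<Rightarrow> 'a" where
  "cyc L e i j = qbinom q (2 * L + e - i) (L + j) * q powi (i * j + choose2 (i + 1 - e)) * alt_sign i"

context
  assumes q_nz: "q \<noteq> 0" and q_powi_neq_1: "\<And>i::int. i > 0 \<Longrightarrow> q powi i \<noteq> 1"
begin

subsection \<open>Gaussian binomial coefficients\<close>

lemma qbinom_absorb:
  assumes "1 \<le> k" "k \<le> n"
  shows "(1 - q powi k) * qbinom q n k = (1 - q powi n) * qbinom q (n - 1) (k - 1)"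
proof -
  have "(\<Prod>i=1..k. 1 - q powi i) = (1 - q powi k) * (\<Prod>i=1..k-1. 1 - q powi i)"
  proof -
    have "{1..k} = insert k {1..k-1}" using assms by auto
    then show ?thesis by simp
  qed
  moreover have "(\<Prod>i=1..k. 1 - q powi (n - i + 1))
      = (1 - q powi n) * (\<Prod>i=1..k-1. 1 - q powi (n - 1 - i + 1))"
  proof -
    have "{1..k} = insert 1 {2..k}" using assms by auto
    then have "(\<Prod>i=1..k. 1 - q powi (n - i + 1)) = (1 - q powi n) * (\<Prod>i=2..k. 1 - q powi (n - i + 1))"
      by simp
    also have "(\<Prod>i=2..k. 1 - q powi (n - i + 1)) = (\<Prod>i=1..k-1. 1 - q powi (n - 1 - i + 1))"
      by (rule prod.reindex_bij_witness[of _ "\<lambda>c. c + 1" "\<lambda>c. c - 1"]) auto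
    finally show ?thesis .
  qed
  moreover have "1 - q powi k \<noteq> 0" using q_powi_neq_1[of k] assms by auto
  ultimately show ?thesis using assms
    by (simp add: qbinom_def prod_dividef)
qed

text \<open>The two coefficients differ by the single factor \<open>i = k\<close> of the defining
  product. At \<open>k = n\<close> both sides are 0.\<close>

lemma qbinom_absorb_lower:
  assumes "1 \<le> k" "k \<le> n"
  shows "(1 - q powi k) * qbinom q (n - 1) k = (1 - q powi (n - k)) * qbinom q (n - 1) (k - 1)"
proof (cases "k = n")
  case False
  then have "k \<le> n - 1" using assms by simp
  moreover have "{1..k} = insert k {1..k-1}" using assms by auto
  moreover have "1 - q powi k \<noteq> 0" using q_powi_neq_1[of k] assms by auto
  ultimately show ?thesis using assms
    by (simp add: qbinom_def)
qed (simp add: qbinom_def)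

text \<open>The excluded case is real: the coefficient at \<open>n = k = 0\<close> is 1, while the coefficients at \<open>n = -1\<close> vanish.\<close>

lemma qbinom_pascal:
  assumes "n \<noteq> 0 \<or> k \<noteq> 0"
  shows "qbinom q n k = qbinom q (n - 1) (k - 1) + q powi k * qbinom q (n - 1) k"
proof (cases "1 \<le> k \<and> k \<le> n")
  case True
  have nz: "1 - q powi k \<noteq> 0" using q_powi_neq_1[of k] True by auto
  have pow: "q powi k * q powi (n - k) = q powi n" using q_nz by (simp flip: power_int_add)
  \<comment> \<open>Absorption reduces the rule to
    \<open>1 - q^n = (1 - q^k) + q^k * (1 - q^(n-k))\<close>.\<close>
  have "(1 - q powi k) * (qbinom q (n - 1) (k - 1) + q powi k * qbinom q (n - 1) k)
      = (1 - q powi k) * qbinom q (n - 1) (k - 1) + q powi k * ((1 - q powi k) * qbinom q (n - 1) k)"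
    by (simp add: algebra_simps)
  also have "(1 - q powi k) * qbinom q (n - 1) k = (1 - q powi (n - k)) * qbinom q (n - 1) (k - 1)"
    using qbinom_absorb_lower[of k n] True by simp
  also have "(1 - q powi k) * qbinom q (n - 1) (k - 1) + q powi k * ((1 - q powi (n - k)) * qbinom q (n - 1) (k - 1))
      = (1 - q powi n) * qbinom q (n - 1) (k - 1)"
    by (simp add: algebra_simps flip: pow)
  also have "\<dots> = (1 - q powi k) * qbinom q n k"
    using qbinom_absorb[of k n] True by simp
  finally show ?thesis using nz by simp
next
  case False
  with assms show ?thesis by (auto simp: qbinom_def)
qed

text \<open>Absorption as before, now with the splitting
  \<open>1 - q^n = q^(n-k) * (1 - q^k) + (1 - q^(n-k))\<close>.\<close>

lemma qbinom_pascal':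
  assumes "n \<noteq> 0 \<or> k \<noteq> 0"
  shows "qbinom q n k = q powi (n - k) * qbinom q (n - 1) (k - 1) + qbinom q (n - 1) k"
proof (cases "1 \<le> k \<and> k \<le> n")
  case True
  have nz: "1 - q powi k \<noteq> 0" using q_powi_neq_1[of k] True by auto
  have pow: "q powi k * q powi (n - k) = q powi n" using q_nz by (simp flip: power_int_add)
  have "(1 - q powi k) * (q powi (n - k) * qbinom q (n - 1) (k - 1) + qbinom q (n - 1) k)
      = q powi (n - k) * (1 - q powi k) * qbinom q (n - 1) (k - 1) + (1 - q powi k) * qbinom q (n - 1) k"
    by (simp add: algebra_simps)
  also have "(1 - q powi k) * qbinom q (n - 1) k = (1 - q powi (n - k)) * qbinom q (n - 1) (k - 1)"
    using qbinom_absorb_lower[of k n] True by simp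
  also have "q powi (n - k) * (1 - q powi k) * qbinom q (n - 1) (k - 1) + (1 - q powi (n - k)) * qbinom q (n - 1) (k - 1)
      = (1 - q powi n) * qbinom q (n - 1) (k - 1)"
    by (simp add: algebra_simps flip: pow)
  also have "\<dots> = (1 - q powi k) * qbinom q n k"
    using qbinom_absorb[of k n] True by simp
  finally show ?thesis using nz by simp
next
  case False
  with assms show ?thesis by (auto simp: qbinom_def)
qed

text \<open>At \<open>q = 1\<close> the sum is the \<open>n\<close>-th backward difference in
  \<open>N\<close> of the binomial coefficient, and each difference lowers both arguments by one.
  The induction takes one \<open>q\<close>-difference per step, splitting the coefficient at
  \<open>Suc n\<close> by the first Pascal rule.\<close>

lemma qbinom_vandermonde:
  assumes "int n \<le> N"
  shows "(\<Sum>c=0..int n. alt_sign c * q powi (choose2 c + c * (1 + b - int n))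
            * qbinom q (int n) c * qbinom q (N - c) b)
       = qbinom q (N - int n) (b - int n)"
  using assms
proof (induction n arbitrary: N)
  case 0
  then show ?case by (simp add: qbinom_def)
next
  case (Suc n)
  define T where "T M c = alt_sign c * q powi (choose2 c + c * (1 + b - int n))
            * qbinom q (int n) c * qbinom q (M - c) b" for M c
  have T0: "T M c = 0" if "c < 0 \<or> c > int n" for M c
    using that by (auto simp: T_def qbinom_def)
  have "alt_sign c * q powi (choose2 c + c * (1 + b - int (Suc n)))
            * qbinom q (int (Suc n)) c * qbinom q (N - c) b
      = T N c - q powi (b - int n) * T (N - 1) (c - 1)" for c
  proof -
    have "qbinom q (int (Suc n)) c = qbinom q (int n) (c - 1) + q powi c * qbinom q (int n) c"
      using qbinom_pascal[of "int (Suc n)" c] by simp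
    moreover have "q powi (choose2 c + c * (1 + b - int (Suc n))) * q powi c
        = q powi (choose2 c + c * (1 + b - int n))"
      using q_nz by (simp add: algebra_simps flip: power_int_add)
    moreover have "q powi (choose2 c + c * (1 + b - int (Suc n)))
        = q powi (b - int n) * q powi (choose2 (c - 1) + (c - 1) * (1 + b - int n))"
      using q_nz by (simp add: choose2_diff algebra_simps flip: power_int_add)
    moreover have "N - c = N - 1 - (c - 1)" by simp
    ultimately show ?thesis
      unfolding T_def by (simp add: alt_sign_diff algebra_simps)
  qed
  then have "(\<Sum>c=0..int (Suc n). alt_sign c * q powi (choose2 c + c * (1 + b - int (Suc n)))
            * qbinom q (int (Suc n)) c * qbinom q (N - c) b)
      = (\<Sum>c=0..int n. T N c) - q powi (b - int n) * (\<Sum>c=0..int n. T (N - 1) c)"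
    by (rule sum_minus_shift_int) (auto simp: T0)
  also have "(\<Sum>c=0..int n. T N c) = qbinom q (N - int n) (b - int n)"
    unfolding T_def using Suc.prems by (intro Suc.IH) simp
  also have "(\<Sum>c=0..int n. T (N - 1) c) = qbinom q (N - 1 - int n) (b - int n)"
    unfolding T_def using Suc.prems by (intro Suc.IH) simp
  \<comment> \<open>The first Pascal rule read backwards; \<open>Suc n \<le> N\<close> makes
    \<open>N - int n\<close> positive, which avoids its exceptional case.\<close>
  finally show ?case
    using qbinom_pascal[of "N - int n" "b - int n"] Suc.prems by (simp add: algebra_simps)
qed

subsection \<open>Finite pentagonal number identities\<close>

lemma pent_term_eq_0: "a < 0 \<or> a > N \<Longrightarrow> pent_term t N a = 0"
  by (auto simp: pent_term_def qbinom_def)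

lemma copent_term_eq_0: "a < 0 \<or> a > N \<Longrightarrow> copent_term t N a = 0"
  by (auto simp: copent_term_def qbinom_def)

lemma pent_pascal':
  assumes "N \<ge> 1"
  shows "pent t N = pent (t - 1) (N - 1) - q powi t * pent (t - 1) (N - 2)"
  unfolding pent_def
proof (rule sum_minus_shift_int)
  fix a
  have "qbinom q (N - a) a = q powi (N - 2 * a) * qbinom q (N - a - 1) (a - 1) + qbinom q (N - a - 1) a"
    using qbinom_pascal'[of "N - a" a] assms by fastforce
  moreover have "q powi (a * a + choose2 (a + 1) - N * a + t * a) * q powi (N - 2 * a)
      = q powi t * q powi ((a - 1) * (a - 1) + choose2 ((a - 1) + 1) - (N - 2) * (a - 1) + (t - 1) * (a - 1))"
    using q_nz by (simp add: choose2_add choose2_diff algebra_simps flip: power_int_add)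
  moreover have "a * a + choose2 (a + 1) - N * a + t * a = a * a + choose2 (a + 1) - (N - 1) * a + (t - 1) * a"
    by (simp add: algebra_simps)
  moreover have "N - a - 1 = N - 2 - (a - 1)" "N - a - 1 = N - 1 - a" by simp_all
  ultimately show "pent_term t N a = pent_term (t - 1) (N - 1) a - q powi t * pent_term (t - 1) (N - 2) (a - 1)"
    unfolding pent_term_def by (simp add: alt_sign_diff algebra_simps)
qed (auto simp: pent_term_eq_0)

lemma pent_pascal:
  assumes "N \<ge> 1"
  shows "pent t N = pent t (N - 1) - q powi (t + 2 - N) * pent (t + 1) (N - 2)"
  unfolding pent_def
proof (rule sum_minus_shift_int)
  fix a
  have "qbinom q (N - a) a = qbinom q (N - a - 1) (a - 1) + q powi a * qbinom q (N - a - 1) a"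
    using qbinom_pascal[of "N - a" a] assms by fastforce
  moreover have "q powi (a * a + choose2 (a + 1) - N * a + t * a)
      = q powi (t + 2 - N) * q powi ((a - 1) * (a - 1) + choose2 ((a - 1) + 1) - (N - 2) * (a - 1) + (t + 1) * (a - 1))"
    using q_nz by (simp add: choose2_add choose2_diff algebra_simps flip: power_int_add)
  moreover have "q powi (a * a + choose2 (a + 1) - N * a + t * a) * q powi a
      = q powi (a * a + choose2 (a + 1) - (N - 1) * a + t * a)"
    using q_nz by (simp add: algebra_simps flip: power_int_add)
  moreover have "N - a - 1 = N - 2 - (a - 1)" "N - a - 1 = N - 1 - a" by simp_all
  ultimately show "pent_term t N a = pent_term t (N - 1) a - q powi (t + 2 - N) * pent_term (t + 1) (N - 2) (a - 1)"
    unfolding pent_term_def by (simp add: alt_sign_diff algebra_simps)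
qed (auto simp: pent_term_eq_0)

text \<open>With lower argument \<open>N - 2 * a\<close>, the summand with both arguments lowered
  belongs to \<open>N - 1\<close> at the same \<open>a\<close>, the other one to
  \<open>N - 2\<close> at \<open>a - 1\<close>; for \<open>pent\<close> it is the other way
  round.\<close>

lemma copent_pascal:
  assumes "N \<ge> 1"
  shows "copent t N = copent t (N - 1) - q powi (N - 2 + t) * copent (t - 1) (N - 2)"
  unfolding copent_def
proof (rule sum_minus_shift_int)
  fix a
  have "qbinom q (N - a) (N - 2 * a)
      = qbinom q (N - a - 1) (N - 2 * a - 1) + q powi (N - 2 * a) * qbinom q (N - a - 1) (N - 2 * a)"
    using qbinom_pascal[of "N - a" "N - 2 * a"] assms by fastforce
  moreover have "q powi (choose2 a + t * a) * q powi (N - 2 * a)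
      = q powi (N - 2 + t) * q powi (choose2 (a - 1) + (t - 1) * (a - 1))"
    using q_nz by (simp add: choose2_add choose2_diff algebra_simps flip: power_int_add)
  moreover have "N - a - 1 = N - 2 - (a - 1)" "N - a - 1 = N - 1 - a"
    "N - 2 * a - 1 = N - 1 - 2 * a" "N - 2 * a = N - 2 - 2 * (a - 1)" by simp_all
  ultimately show "copent_term t N a = copent_term t (N - 1) a - q powi (N - 2 + t) * copent_term (t - 1) (N - 2) (a - 1)"
    unfolding copent_term_def by (simp add: alt_sign_diff algebra_simps)
qed (auto simp: copent_term_eq_0)

lemma copent_pascal':
  assumes "N \<ge> 1"
  shows "copent t N = copent (t + 1) (N - 1) - q powi t * copent (t + 1) (N - 2)"
  unfolding copent_def
proof (rule sum_minus_shift_int)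
  fix a
  have "qbinom q (N - a) (N - 2 * a)
      = q powi a * qbinom q (N - a - 1) (N - 2 * a - 1) + qbinom q (N - a - 1) (N - 2 * a)"
    using qbinom_pascal'[of "N - a" "N - 2 * a"] assms by fastforce
  moreover have "q powi (choose2 a + t * a) = q powi t * q powi (choose2 (a - 1) + (t + 1) * (a - 1))"
    using q_nz by (simp add: choose2_add choose2_diff algebra_simps flip: power_int_add)
  moreover have "q powi (choose2 a + t * a) * q powi a = q powi (choose2 a + (t + 1) * a)"
    using q_nz by (simp add: algebra_simps flip: power_int_add)
  moreover have "N - a - 1 = N - 2 - (a - 1)" "N - a - 1 = N - 1 - a"
    "N - 2 * a - 1 = N - 1 - 2 * a" "N - 2 * a = N - 2 - 2 * (a - 1)" by simp_all
  ultimately show "copent_term t N a = copent_term (t + 1) (N - 1) a - q powi t * copent_term (t + 1) (N - 2) (a - 1)"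
    unfolding copent_term_def by (simp add: alt_sign_diff algebra_simps)
qed (auto simp: copent_term_eq_0)

text \<open>The second Pascal rule at \<open>N\<close> gives sums at \<open>N - 1\<close> and
  \<open>N - 2\<close> with \<open>t = -1\<close>. The first rule turns the former into the latter
  plus a multiple of \<open>pent 0 (N - 3)\<close>, and the two sums at \<open>N - 2\<close>
  cancel.\<close>

lemma pent_rec: "N \<ge> 2 \<Longrightarrow> pent 0 N = - (q powi (2 - N) * pent 0 (N - 3))"
  using pent_pascal'[of N 0] pent_pascal[of "N - 1" "-1"] by simp

lemma copent_rec: "N \<ge> 2 \<Longrightarrow> copent 0 N = - (q powi (N - 2) * copent 0 (N - 3))"
  using copent_pascal'[of N 0] copent_pascal[of "N - 1" 1] by simp

text \<open>Up to sign the exponents are the pentagonal numbers \<open>n * (3 * n - 1) / 2\<close>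
  for \<open>e = 0\<close> and \<open>n * (3 * n + 1) / 2\<close> for \<open>e = 1\<close>.\<close>

lemma pent_eval:
  assumes "e = 0 \<or> e = 1"
  shows "pent 0 (3 * int n + e) = alt_sign (int n) * q powi (- 3 * choose2 (int n) - int n * (e + 1))"
proof (induction n)
  case 0
  have "{0..1::int} = {0, 1}" by auto
  then show ?case using assms by (auto simp: pent_def pent_term_def qbinom_def)
next
  case (Suc n)
  have "pent 0 (3 * int (Suc n) + e) = - (q powi (- 1 - 3 * int n - e) * pent 0 (3 * int n + e))"
    using pent_rec[of "3 * int (Suc n) + e"] assms by (auto simp: algebra_simps)
  then show ?case unfolding Suc.IH using q_nz
    by (simp add: alt_sign_add choose2_add algebra_simps flip: power_int_add)
qed

lemma copent_eval:
  assumes "e = 0 \<or> e = 1"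
  shows "copent 0 (3 * int n + e) = alt_sign (int n) * q powi (3 * choose2 (int n) + int n * (e + 1))"
proof (induction n)
  case 0
  have "{0..1::int} = {0, 1}" by auto
  \<comment> \<open>For \<open>e = 1\<close> the surviving coefficient is
    \<open>(1 - q) / (1 - q)\<close>, which is 1 because \<open>q\<close> is not 1.\<close>
  then show ?case using assms q_powi_neq_1[of 1]
    by (auto simp: copent_def copent_term_def qbinom_def)
next
  case (Suc n)
  have "copent 0 (3 * int (Suc n) + e) = - (q powi (1 + 3 * int n + e) * copent 0 (3 * int n + e))"
    using copent_rec[of "3 * int (Suc n) + e"] assms by (auto simp: algebra_simps)
  then show ?case unfolding Suc.IH using q_nz
    by (simp add: alt_sign_add choose2_add algebra_simps flip: power_int_add)
qed

subsection \<open>The matrix of order three\<close>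

text \<open>With \<open>c = j + L\<close> the two coefficients are those of
  \<open>qbinom_vandermonde\<close> for \<open>n = 2 * L + e - i\<close>,
  \<open>N = 3 * L + e\<close> and \<open>b = L + k\<close>. The bounds on \<open>i\<close> say
  exactly that \<open>0 \<le> n \<le> N\<close>.\<close>

lemma cyc_square:
  assumes e: "e = 0 \<or> e = 1" and i: "- L \<le> i" "i \<le> 2 * L + e"
  shows "(\<Sum>j=-L..2*L+e. cyc L e i j * cyc L e j k)
    = alt_sign (i + L) * q powi (choose2 (i + 1 - e) - choose2 L - L * (1 + k - L - e + i))
        * qbinom q (L + i) (k + i - L - e)" (is "_ = ?s * ?p * _")
proof -
  define n where "n = nat (2 * L + e - i)"
  have n: "int n = 2 * L + e - i" using i by (simp add: n_def)
  define T where "T c = alt_sign c * q powi (choose2 c + c * (1 + (L + k) - int n))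
            * qbinom q (int n) c * qbinom q (3 * L + e - c) (L + k)" for c
  have "cyc L e i j * cyc L e j k = ?s * ?p * T (j - (- L))" for j
  proof -
    have "q powi (i * j + choose2 (i + 1 - e)) * q powi (j * k + choose2 (j + 1 - e))
        = ?p * q powi (choose2 (j - (- L)) + (j - (- L)) * (1 + (L + k) - int n))"
      unfolding choose2_diff_bit[OF e] using q_nz
      by (simp add: n choose2_add algebra_simps flip: power_int_add)
    moreover have "3 * L + e - (j - (- L)) = 2 * L + e - j" by simp
    ultimately show ?thesis
      unfolding cyc_def T_def n[symmetric] by (simp add: alt_sign_add algebra_simps)
  qed
  then have "(\<Sum>j=-L..2*L+e. cyc L e i j * cyc L e j k) = ?s * ?p * (\<Sum>j=-L..2*L+e. T (j - (- L)))"
    by (simp add: sum_distrib_left)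
  also have "(\<Sum>j=-L..2*L+e. T (j - (- L))) = (\<Sum>c=0..3*L+e. T c)"
    by (subst sum_shift_int) (simp add: algebra_simps)
  also have "\<dots> = (\<Sum>c=0..int n. T c)"
    using i by (intro sum.mono_neutral_right) (auto simp: T_def qbinom_def n)
  also have "\<dots> = qbinom q (3 * L + e - int n) (L + k - int n)"
    unfolding T_def using i by (intro qbinom_vandermonde) (simp add: n)
  finally show ?thesis by (simp add: n algebra_simps)
qed

text \<open>After inserting the closed form of the square, Vandermonde applies with
  \<open>N = n = L + h\<close>. It leaves a coefficient with upper argument 0, which is a Kronecker
  delta.\<close>

lemma cyc_cube:
  assumes e: "e = 0 \<or> e = 1" and h: "- L \<le> h" "h \<le> 2 * L + e"
  shows "(\<Sum>i=-L..2*L+e. (\<Sum>j=-L..2*L+e. cyc L e h j * cyc L e j i) * cyc L e i k)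
    = (if h = k then alt_sign e else 0)"
proof -
  define n where "n = nat (L + h)"
  have n: "int n = L + h" using h by (simp add: n_def)
  define d where "d = L + e - h"
  \<comment> \<open>The power of \<open>q\<close> that does not depend on \<open>i\<close>. Only its
    value for \<open>h = k\<close> matters, since the delta removes all other entries.\<close>
  define r where "r = q powi (choose2 (h + 1 - e) - choose2 L - L * (1 - L - e + h)
      - choose2 d + d * (k - h))"
  have r_diag: "r = 1" if "h = k"
  proof -
    have "choose2 e = 0" using e by auto
    then show ?thesis
      unfolding r_def choose2_diff_bit[OF e] using that choose2_double[of L]
      by (simp add: d_def choose2_diff[of "L + e" k] choose2_add[of L e] algebra_simps)
  qed
  define T where "T c = alt_sign c * q powi (choose2 c + c * (1 + (L + k) - int n))
            * qbinom q (int n) c * qbinom q (int n - c) (L + k)" for c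
  have "(\<Sum>j=-L..2*L+e. cyc L e h j * cyc L e j i) * cyc L e i k = alt_sign e * r * T (i - d)" for i
  proof -
    have "q powi (choose2 (h + 1 - e) - choose2 L - L * (1 + i - L - e + h)) * q powi (i * k + choose2 (i + 1 - e))
        = r * q powi (choose2 (i - d) + (i - d) * (1 + (L + k) - int n))"
      unfolding r_def choose2_diff_bit[OF e] using q_nz
      by (simp add: d_def n choose2_add choose2_diff algebra_simps
          flip: power_int_add)
    moreover have *: "int n - (i - d) = 2 * L + e - i" "i + h - L - e = i - d" by (simp_all add: n d_def)
    moreover have "alt_sign (h + L) * alt_sign i = alt_sign e * (alt_sign (i - d) :: 'a)"
      by (simp add: d_def alt_sign_add alt_sign_diff mult_ac)
    moreover have "s * p * b * (b' * p' * s') = (s * s') * (p * p') * (b * b')" for s p b b' p' s' :: 'a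
      by (simp only: mult_ac)
    ultimately show ?thesis
      unfolding cyc_square[OF e h] cyc_def[of L e i k] T_def n[symmetric] *
      by (simp only:) (simp only: mult_ac)
  qed
  then have "(\<Sum>i=-L..2*L+e. (\<Sum>j=-L..2*L+e. cyc L e h j * cyc L e j i) * cyc L e i k)
      = alt_sign e * r * (\<Sum>i=-L..2*L+e. T (i - d))"
    by (simp add: sum_distrib_left)
  also have "(\<Sum>i=-L..2*L+e. T (i - d)) = (\<Sum>c=h-2*L-e..h+L. T c)"
    by (subst sum_shift_int) (simp add: d_def algebra_simps)
  also have "\<dots> = (\<Sum>c=0..int n. T c)"
    using h by (intro sum.mono_neutral_right) (auto simp: T_def qbinom_def n)
  also have "\<dots> = qbinom q 0 (L + k - int n)"
    unfolding T_def using qbinom_vandermonde[of n "int n" "L + k"] by simp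
  also have "\<dots> = (if h = k then 1 else 0)"
    by (auto simp: qbinom_def n)
  finally show ?thesis
    using r_diag by auto
qed

text \<open>Under \<open>a = i + L\<close> the diagonal becomes the summand of
  \<open>pent 0 (3 * L + e)\<close> times \<open>r\<close>, and \<open>r\<close> is the inverse of
  the value in \<open>pent_eval\<close>.\<close>

lemma cyc_trace:
  assumes e: "e = 0 \<or> e = 1" and L: "L \<ge> 0"
  shows "(\<Sum>i=-L..2*L+e. cyc L e i i) = 1"
proof -
  define r :: 'a where "r = alt_sign L * q powi (3 * choose2 L + L * (e + 1))"
  have "cyc L e i i = r * pent_term 0 (3 * L + e) (i - (- L))" for i
  proof -
    have "q powi (i * i + choose2 (i + 1 - e)) = q powi (3 * choose2 L + L * (e + 1))
        * q powi ((i + L) * (i + L) + choose2 (i + L + 1) - (3 * L + e) * (i + L) + 0 * (i + L))"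
    proof -
      \<comment> \<open>Doubling turns each \<open>choose2\<close> into a polynomial.\<close>
      have "2 * (i * i + choose2 (i + 1 - e)) = 2 * (3 * choose2 L + L * (e + 1)
          + ((i + L) * (i + L) + choose2 (i + L + 1) - (3 * L + e) * (i + L) + 0 * (i + L)))"
        (is "2 * ?l = 2 * ?r")
        using choose2_double[of L] choose2_double[of i] choose2_double[of "i + L + 1"]
        unfolding choose2_diff_bit[OF e] by algebra
      then have "?l = ?r" by (rule mult_left_cancel[THEN iffD1, rotated]) simp
      then show ?thesis by (simp only: power_int_add[OF disjI1[OF q_nz]])
    qed
    moreover have "3 * L + e - (i + L) = 2 * L + e - i" by simp
    ultimately show ?thesis
      unfolding cyc_def pent_term_def r_def by (simp add: alt_sign_add algebra_simps)
  qed
  then have "(\<Sum>i=-L..2*L+e. cyc L e i i) = r * (\<Sum>i=-L..2*L+e. pent_term 0 (3 * L + e) (i - (- L)))"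
    by (simp add: sum_distrib_left)
  also have "(\<Sum>i=-L..2*L+e. pent_term 0 (3 * L + e) (i - (- L))) = pent 0 (3 * L + e)"
    unfolding pent_def by (subst sum_shift_int) (simp add: algebra_simps)
  also have "r * pent 0 (3 * L + e) = 1"
    using pent_eval[OF e, of "nat L"] L q_nz
    by (simp add: r_def mult_ac flip: power_int_add)
  finally show ?thesis .
qed

text \<open>The closed form of the square at \<open>k = i\<close>, read from the upper end by
  \<open>a = 2 * L + e - i\<close>, is a constant times the summand of
  \<open>copent 0 (3 * L + e)\<close>.\<close>

lemma cyc_square_trace:
  assumes e: "e = 0 \<or> e = 1" and L: "L \<ge> 0"
  shows "(\<Sum>i=-L..2*L+e. \<Sum>j=-L..2*L+e. cyc L e i j * cyc L e j i) = alt_sign e"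
proof -
  define r :: 'a where "r = alt_sign e * (alt_sign L * q powi (- 3 * choose2 L - L * (e + 1)))"
  have "(\<Sum>i=-L..2*L+e. \<Sum>j=-L..2*L+e. cyc L e i j * cyc L e j i)
      = (\<Sum>a=0..3*L+e. r * copent_term 0 (3 * L + e) a)"
  proof (rule sum.reindex_bij_witness[of _ "\<lambda>a. 2 * L + e - a" "\<lambda>i. 2 * L + e - i"])
    fix i assume i: "i \<in> {- L..2 * L + e}"
    define a where "a = 2 * L + e - i"
    have ia: "i = 2 * L + e - a" by (simp add: a_def)
    have "q powi (choose2 (i + 1 - e) - choose2 L - L * (1 + i - L - e + i))
        = q powi (- 3 * choose2 L - L * (e + 1)) * q powi (choose2 a + 0 * a)"
    proof -
      have "choose2 (i + 1 - e) - choose2 L - L * (1 + i - L - e + i)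
          = - 3 * choose2 L - L * (e + 1) + (choose2 a + 0 * a)"
        using e choose2_double[of L] choose2_double[of i] choose2_double[of a]
        unfolding choose2_diff_bit[OF e] ia by (auto simp: algebra_simps)
      then show ?thesis by (simp only: power_int_add[OF disjI1[OF q_nz]])
    qed
    moreover have *: "3 * L + e - a = L + i" "3 * L + e - 2 * a = i + i - L - e"
      by (simp_all add: a_def)
    moreover have "(alt_sign (i + L) :: 'a) = alt_sign e * alt_sign L * alt_sign a"
    proof -
      have "i + L = e + L - a + (L + L)" by (simp add: ia)
      then show ?thesis by (simp only: alt_sign_add alt_sign_diff alt_sign_square mult_1_right)
    qed
    ultimately show "r * copent_term 0 (3 * L + e) (2 * L + e - i)
        = (\<Sum>j=-L..2*L+e. cyc L e i j * cyc L e j i)"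
      using i unfolding a_def[symmetric] copent_term_def r_def *
      by (subst cyc_square[OF e]) (simp_all add: mult_ac del: mult_cancel_left mult_cancel_right)
  qed auto
  also have "\<dots> = r * copent 0 (3 * L + e)"
    by (simp add: copent_def sum_distrib_left)
  also have "\<dots> = alt_sign e"
    using copent_eval[OF e, of "nat L"] L q_nz
    by (simp add: r_def mult_ac flip: power_int_add)
  finally show ?thesis .
qed

end

end

subsection \<open>Cyclic sums as traces\<close>

text \<open>Entries of the \<open>m\<close>-th power of the matrix \<open>A\<close> with rows and
  columns indexed by \<open>S\<close>, so that an integer interval can be the index set.\<close>

primrec walk_sum :: "('i \<Rightarrow> 'i \<Rightarrow> 'a::comm_semiring_1) \<Rightarrow> 'i set \<Rightarrow> nat \<Rightarrow> 'i \<Rightarrow> 'i \<Rightarrow> 'a" where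
  "walk_sum A S 0 x y = (if x = y then 1 else 0)"
| "walk_sum A S (Suc m) x y = (\<Sum>z\<in>S. walk_sum A S m x z * A z y)"

lemma walk_sum_1:
  assumes "finite S" "x \<in> S"
  shows "walk_sum A S (Suc 0) x y = A x y"
proof -
  have "walk_sum A S (Suc 0) x y = (\<Sum>z\<in>S. if x = z then A x y else 0)"
    by (auto intro!: sum.cong)
  then show ?thesis using assms by simp
qed

lemma sum_PiE_insert:
  assumes "x \<notin> I"
  shows "(\<Sum>g\<in>insert x I \<rightarrow>\<^sub>E S. F g) = (\<Sum>g\<in>I \<rightarrow>\<^sub>E S. \<Sum>y\<in>S. F (g(x := y)))"
proof -
  have "(\<Sum>g\<in>insert x I \<rightarrow>\<^sub>E S. F g) = (\<Sum>(y, g)\<in>S \<times> (I \<rightarrow>\<^sub>E S). F (g(x := y)))"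
    unfolding PiE_insert_eq
    by (subst sum.reindex[OF inj_combinator[OF assms]]) (auto intro: sum.cong)
  also have "\<dots> = (\<Sum>y\<in>S. \<Sum>g\<in>I \<rightarrow>\<^sub>E S. F (g(x := y)))"
    by (simp add: sum.cartesian_product)
  also have "\<dots> = (\<Sum>g\<in>I \<rightarrow>\<^sub>E S. \<Sum>y\<in>S. F (g(x := y)))"
    by (rule sum.swap)
  finally show ?thesis .
qed

text \<open>The weight \<open>u\<close> on the two end points is arbitrary so that the induction can
  remove the last vertex and absorb the last edge into \<open>u\<close>.\<close>

lemma sum_PiE_path:
  assumes "finite S"
  shows "(\<Sum>j\<in>{1..Suc m} \<rightarrow>\<^sub>E S. u (j 1) (j (Suc m)) * (\<Prod>k=1..m. A (j k) (j (k + 1))))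
    = (\<Sum>x\<in>S. \<Sum>y\<in>S. u x y * walk_sum A S m x y)"
proof (induction m arbitrary: u)
  case 0
  have "(\<Sum>j\<in>insert 1 {} \<rightarrow>\<^sub>E S. u (j (1::nat)) (j 1)) = (\<Sum>x\<in>S. u x x)"
    by (subst sum_PiE_insert) auto
  moreover have "u x y * walk_sum A S 0 x y = (if x = y then u x x else 0)" for x y
    by simp
  ultimately show ?case using assms by (simp del: walk_sum.simps)
next
  case (Suc m)
  have "(\<Sum>j\<in>{1..Suc (Suc m)} \<rightarrow>\<^sub>E S. u (j 1) (j (Suc (Suc m))) * (\<Prod>k=1..Suc m. A (j k) (j (k + 1))))
      = (\<Sum>j\<in>{1..Suc m} \<rightarrow>\<^sub>E S. \<Sum>y\<in>S. u (j 1) y * (A (j (Suc m)) y * (\<Prod>k=1..m. A (j k) (j (k + 1)))))"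
    (is "?lhs = _")
  proof -
    have "{1..Suc (Suc m)} = insert (Suc (Suc m)) {1..Suc m}" by auto
    then show ?thesis
      by (simp only:) (subst sum_PiE_insert, auto intro!: sum.cong prod.cong arg_cong2[of _ _ _ _ "(*)"] simp: mult_ac)
  qed
  also have "\<dots> = (\<Sum>j\<in>{1..Suc m} \<rightarrow>\<^sub>E S. (\<Sum>y\<in>S. u (j 1) y * A (j (Suc m)) y) * (\<Prod>k=1..m. A (j k) (j (k + 1))))"
    by (simp only: sum_distrib_right mult.assoc)
  \<comment> \<open>The inner sum over \<open>y\<close> is the new end-point weight.\<close>
  also have "\<dots> = (\<Sum>x\<in>S. \<Sum>z\<in>S. (\<Sum>y\<in>S. u x y * A z y) * walk_sum A S m x z)"
    by (rule Suc.IH)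
  also have "\<dots> = (\<Sum>x\<in>S. \<Sum>y\<in>S. u x y * walk_sum A S (Suc m) x y)"
    proof (rule sum.cong[OF refl])
    fix x
    have "(\<Sum>z\<in>S. (\<Sum>y\<in>S. u x y * A z y) * walk_sum A S m x z)
        = (\<Sum>z\<in>S. \<Sum>y\<in>S. u x y * (walk_sum A S m x z * A z y))"
      by (simp add: sum_distrib_left mult_ac)
    also have "\<dots> = (\<Sum>y\<in>S. \<Sum>z\<in>S. u x y * (walk_sum A S m x z * A z y))"
      by (rule sum.swap)
    finally show "(\<Sum>z\<in>S. (\<Sum>y\<in>S. u x y * A z y) * walk_sum A S m x z)
        = (\<Sum>y\<in>S. u x y * walk_sum A S (Suc m) x y)"
      by (simp add: sum_distrib_left)
  qed
  finally show ?case .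
qed

text \<open>A cycle is a path with \<open>m - 1\<close> edges whose end-point weight is the closing
  edge \<open>A y x\<close>.\<close>

lemma sum_PiE_cycle:
  assumes "finite S" "m \<ge> 1"
  shows "(\<Sum>j\<in>{1..m} \<rightarrow>\<^sub>E S. \<Prod>k=1..m. A (j k) (j (if k = m then 1 else k + 1)))
    = (\<Sum>x\<in>S. walk_sum A S m x x)"
proof -
  obtain n where m: "m = Suc n" using assms(2) by (cases m) auto
  have "(\<Prod>k=1..m. A (j k) (j (if k = m then 1 else k + 1)))
      = A (j (Suc n)) (j 1) * (\<Prod>k=1..n. A (j k) (j (k + 1)))" for j
    by (auto simp: m mult_ac intro!: prod.cong)
  then have "(\<Sum>j\<in>{1..m} \<rightarrow>\<^sub>E S. \<Prod>k=1..m. A (j k) (j (if k = m then 1 else k + 1)))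
      = (\<Sum>x\<in>S. \<Sum>y\<in>S. A y x * walk_sum A S n x y)"
    unfolding m using sum_PiE_path[OF assms(1), where m = n and u = "\<lambda>x y. A y x" and A = A] by simp
  also have "\<dots> = (\<Sum>x\<in>S. walk_sum A S m x x)"
    by (simp add: m mult_ac)
  finally show ?thesis .
qed

lemma walk_sum_add_3:
  fixes c :: "'a::comm_semiring_1"
  assumes "finite S" "y \<in> S"
    and cube: "\<And>x y. x \<in> S \<Longrightarrow> (\<Sum>i\<in>S. (\<Sum>j\<in>S. A x j * A j i) * A i y) = (if x = y then c else 0)"
  shows "walk_sum A S (m + 3) x y = c * walk_sum A S m x y"
proof -
  have "walk_sum A S (m + 3) x y
      = (\<Sum>i\<in>S. \<Sum>j\<in>S. \<Sum>z\<in>S. walk_sum A S m x z * A z j * A j i * A i y)"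
    by (simp add: numeral_3_eq_3 sum_distrib_right)
  also have "\<dots> = (\<Sum>i\<in>S. \<Sum>z\<in>S. \<Sum>j\<in>S. walk_sum A S m x z * A z j * A j i * A i y)"
    by (intro sum.cong refl sum.swap)
  also have "\<dots> = (\<Sum>z\<in>S. \<Sum>i\<in>S. \<Sum>j\<in>S. walk_sum A S m x z * A z j * A j i * A i y)"
    by (rule sum.swap)
  also have "\<dots> = (\<Sum>z\<in>S. walk_sum A S m x z * (\<Sum>i\<in>S. (\<Sum>j\<in>S. A z j * A j i) * A i y))"
    by (simp add: sum_distrib_right sum_distrib_left mult_ac)
  also have "\<dots> = (\<Sum>z\<in>S. if z = y then walk_sum A S m x z * c else 0)"
    by (intro sum.cong) (auto simp: cube)
  finally show ?thesis using assms(1,2) by (simp add: mult_ac)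
qed

lemma walk_sum_trace_mod_3:
  fixes c :: "'a::comm_semiring_1"
  assumes "finite S"
    and cube: "\<And>x y. x \<in> S \<Longrightarrow> (\<Sum>i\<in>S. (\<Sum>j\<in>S. A x j * A j i) * A i y) = (if x = y then c else 0)"
  shows "(\<Sum>x\<in>S. walk_sum A S m x x) = c ^ (m div 3) * (\<Sum>x\<in>S. walk_sum A S (m mod 3) x x)"
proof -
  have "(\<Sum>x\<in>S. walk_sum A S (r + 3 * d) x x) = c ^ d * (\<Sum>x\<in>S. walk_sum A S r x x)" for r d
  proof (induction d)
    case (Suc d)
    have "walk_sum A S (r + 3 * Suc d) x x = c * walk_sum A S (r + 3 * d) x x" if "x \<in> S" for x
      using walk_sum_add_3[OF assms(1) that cube, where m = "r + 3 * d"] by (simp add: add_ac)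
    then have "(\<Sum>x\<in>S. walk_sum A S (r + 3 * Suc d) x x) = c * (\<Sum>x\<in>S. walk_sum A S (r + 3 * d) x x)"
      by (simp only: sum_distrib_left cong: sum.cong)
    then show ?case by (simp only: Suc.IH power_Suc mult.assoc)
  qed simp
  from this[of "m mod 3" "m div 3"] show ?thesis by simp
qed

subsection \<open>Specialisation to the indeterminate\<close>

lemma qvar_nz: "qvar \<noteq> 0"
  by (simp add: qvar_def)

text \<open>A positive power of the indeterminate has positive degree, and \<open>to_fract\<close>
  is injective.\<close>

lemma qvar_powi_neq_1:
  assumes "i > 0"
  shows "qvar powi i \<noteq> 1"
proof -
  have "to_fract (p ^ n) = to_fract p ^ n" for p :: "rat poly" and n
    by (induction n) auto
  then have "qvar powi i = to_fract ([:0, 1:] ^ nat i)"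
    using assms by (simp add: power_int_def qvar_def)
  moreover have "degree ([:0, 1:] ^ nat i :: rat poly) = nat i"
    by (simp add: degree_power_eq)
  then have "([:0, 1:] ^ nat i :: rat poly) \<noteq> 1"
    using assms by (metis degree_1 zero_less_nat_eq less_irrefl)
  ultimately show ?thesis by (metis to_fract_1 to_fract_eq_iff)
qed

lemma cyc_qvar_sum:
  assumes e: "e = 0 \<or> e = 1" and L: "L \<ge> 0" and m: "m \<ge> 1"
  shows "(\<Sum>j\<in>{1..m} \<rightarrow>\<^sub>E {-L..2*L+e}. \<Prod>k=1..m. cyc qvar L e (j k) (j (if k = m then 1 else k + 1)))
    = alt_sign e ^ (m div 3)
        * (if m mod 3 = 0 then of_int (3 * L + e + 1) else if m mod 3 = 1 then 1 else alt_sign e)"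
proof -
  let ?S = "{-L..2*L+e}" and ?A = "cyc qvar L e"
  have "(\<Sum>j\<in>{1..m} \<rightarrow>\<^sub>E ?S. \<Prod>k=1..m. ?A (j k) (j (if k = m then 1 else k + 1)))
      = alt_sign e ^ (m div 3) * (\<Sum>x\<in>?S. walk_sum ?A ?S (m mod 3) x x)"
    by (subst sum_PiE_cycle[OF _ m], simp,
        rule walk_sum_trace_mod_3[OF _ cyc_cube[OF qvar_nz qvar_powi_neq_1 e]]) auto
  \<comment> \<open>The trace of the identity matrix counts the indices.\<close>
  moreover have "(\<Sum>x\<in>?S. walk_sum ?A ?S 0 x x) = of_int (3 * L + e + 1)"
    using L e by auto
  moreover have "(\<Sum>x\<in>?S. walk_sum ?A ?S 1 x x) = 1"
    using cyc_trace[OF qvar_nz qvar_powi_neq_1 e L] by (simp add: walk_sum_1 del: walk_sum.simps)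
  moreover have "(\<Sum>x\<in>?S. walk_sum ?A ?S 2 x x) = alt_sign e"
    using cyc_square_trace[OF qvar_nz qvar_powi_neq_1 e L]
    by (simp add: numeral_2_eq_2 walk_sum.simps(2)[of _ _ "Suc 0"] walk_sum_1 del: walk_sum.simps)
  moreover have "m mod 3 = 0 \<or> m mod 3 = 1 \<or> m mod 3 = 2" by linarith
  ultimately show ?thesis by auto
qed

text \<open>For \<open>m = 3 * d + 1\<close> the exponent is \<open>3 * d^2 + 2 * d\<close>, of the
  parity of \<open>d\<close>; for \<open>m = 3 * d + 2\<close> it is
  \<open>3 * d^2 + 4 * d + 1\<close>, of the opposite parity.\<close>

lemma minus_one_power_square_div_3:
  assumes "m mod 3 \<noteq> 0"
  shows "(-1) ^ (m\<^sup>2 div 3) = (-1 :: 'a::ring_1) ^ (m div 3) * (if m mod 3 = 1 then 1 else - 1)"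
proof -
  define d where "d = m div 3"
  have "m = 3 * d + 1 \<or> m = 3 * d + 2" using assms unfolding d_def by presburger
  then show ?thesis
  proof
    assume m: "m = 3 * d + 1"
    have "m\<^sup>2 = 3 * (3 * d\<^sup>2 + 2 * d) + 1" by (simp add: m power2_eq_square algebra_simps)
    then have "m\<^sup>2 div 3 = 3 * d\<^sup>2 + 2 * d" by simp
    moreover have "m div 3 = d" "m mod 3 = 1" using m by presburger+
    ultimately show ?thesis by (simp add: minus_one_power_iff)
  next
    assume m: "m = 3 * d + 2"
    have "m\<^sup>2 = 3 * (3 * d\<^sup>2 + 4 * d + 1) + 1" by (simp add: m power2_eq_square algebra_simps)
    then have "m\<^sup>2 div 3 = 3 * d\<^sup>2 + 4 * d + 1" by simp
    moreover have "m div 3 = d" "m mod 3 = 2" using m by presburger+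
    ultimately show ?thesis by (simp add: minus_one_power_iff)
  qed
qed

theorem corollary2p5:
  fixes L :: int and m :: nat
  assumes "L \<ge> 1" and "m \<ge> 1"
  shows
    "(\<Sum>j \<in> {1..m} \<rightarrow>\<^sub>E {- L..2 * L}. \<Prod>k = 1..m.
        let j' = j (if k = m then 1 else k + 1) in
          qbinom qvar (2 * L - j k) (L + j')
            * qvar powi (j k * j' + choose2 (j k + 1)) * (-1) powi (j k))
      = (if m mod 3 \<noteq> 0 then 1 else of_int (3 * L + 1))
   \<and> (\<Sum>j \<in> {1..m} \<rightarrow>\<^sub>E {- L..2 * L + 1}. \<Prod>k = 1..m.
        let j' = j (if k = m then 1 else k + 1) in
          qbinom qvar (2 * L - j k + 1) (L + j')
            * qvar powi (j k * j' + choose2 (j k)) * (-1) powi (j k))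
      = (if m mod 3 \<noteq> 0 then (-1) ^ (m ^ 2 div 3) else (-1) ^ (m div 3) * of_int (3 * L + 2))"
proof
  have "cyc qvar L 0 i j = qbinom qvar (2 * L - i) (L + j) * qvar powi (i * j + choose2 (i + 1)) * (-1) powi i" for i j
    by (simp add: cyc_def alt_sign_def)
  then show "(\<Sum>j \<in> {1..m} \<rightarrow>\<^sub>E {- L..2 * L}. \<Prod>k = 1..m.
        let j' = j (if k = m then 1 else k + 1) in
          qbinom qvar (2 * L - j k) (L + j')
            * qvar powi (j k * j' + choose2 (j k + 1)) * (-1) powi (j k))
      = (if m mod 3 \<noteq> 0 then 1 else of_int (3 * L + 1))"
    using cyc_qvar_sum[of 0 L m] assms by (simp add: Let_def)
next
  have "cyc qvar L 1 i j = qbinom qvar (2 * L - i + 1) (L + j) * qvar powi (i * j + choose2 i) * (-1) powi i" for i j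
    by (simp add: cyc_def alt_sign_def algebra_simps)
  then show "(\<Sum>j \<in> {1..m} \<rightarrow>\<^sub>E {- L..2 * L + 1}. \<Prod>k = 1..m.
        let j' = j (if k = m then 1 else k + 1) in
          qbinom qvar (2 * L - j k + 1) (L + j')
            * qvar powi (j k * j' + choose2 (j k)) * (-1) powi (j k))
      = (if m mod 3 \<noteq> 0 then (-1) ^ (m ^ 2 div 3) else (-1) ^ (m div 3) * of_int (3 * L + 2))"
    using cyc_qvar_sum[of 1 L m] minus_one_power_square_div_3[of m, where 'a = "rat poly fract"] assms by (simp add: Let_def)
qed

end
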